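(* Let $\mathcal{M}$ be a smooth manifold without boundary, equipped with the diffeology whose plots are the smooth maps $U\to\mathcal{M}$ from arbitrary domains $U$, and let $Bar$ be equipped with its canonical diffeology $\mathcal{D}(Bar)$. Then the smooth maps of diffeological spaces from $\mathcal{M}$ to $Bar$ are exactly the maps $\mathcal{M}\to Bar$ that are $\infty$-differentiable (at every point of $\mathcal{M}$).
   Context: Barcodes: a barcode is a multiset $D=D'\cup\Delta^\infty$, where $D'$ is a finite multiset of elements of $\mathbb{R}\times(\mathbb{R}\cup\{+\infty\})$ and $\Delta^\infty$ consists of the diagonal $\Delta=\{(b,b)\mid b\in\mathbb{R}\}$ with countably infinite multiplicity. $Bar$ is the set of barcodes. For $m,n\in\mathbb{N}$, $Q_{m,n}:\mathbb{R}^{2m}\times\mathbb{R}^n\to Bar$ is $Q_{m,n}(b_1,d_1,\dots,b_m,d_m,v_1,\dots,v_n)=\{(b_i,d_i)\}_{i=1}^m\cup\{(v_j,+\infty)\}_{j=1}^n\cup\Delta^\infty$. A map $B:\mathcal{M}\to Bar$ is $\infty$-differentiable at $x\in\mathcal{M}$ if there are an open neighborhood $U$ of $x$, integers $m,n\in\mathbb{N}$ and a $C^\infty$ map $\tilde B:U\to\mathbb{R}^{2m}\times\mathbb{R}^n$ with $B=Q_{m,n}\circ\tilde B$ on $U$. A domain is an open subset of some Euclidean space. A diffeology on a nonempty set $S$ is a collection of maps $P:U\to S$ from domains $U$ (called plots) such that: all constant maps $\mathbb{R}^n\to S$ are plots; a map $P:U\to S$ that restricts to a plot on a neighborhood of each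 point of $U$ is a plot; and $P\circ F$ is a plot for every plot $P:U\to S$ and every smooth map $F:W\to U$ with $W$ a domain. A map between diffeological spaces is smooth if its composition with every plot of the source is a plot of the target. A diffeology is finer than another if it is contained in it. Each $\mathbb{R}^{2m+n}$ carries its Euclidean diffeology (plots are the $C^\infty$ maps from domains). The sum diffeology on $\bigsqcup_{m,n\in\mathbb{N}}\mathbb{R}^{2m+n}$ is the finest diffeology making all the inclusions smooth. As a set, $Bar\cong\big(\bigsqcup_{m,n\in\mathbb{N}}\mathbb{R}^{2m+n}\big)/\!\sim$, where two ordered barcodes are equivalent if and only if they have the same image under the maps $Q_{m,n}$. The canonical diffeology $\mathcal{D}(Bar)$ is the quotient diffeology, that is, the finest diffeology on $Bar$ making the quotient map $\bigsqcup_{m,n}\mathbb{R}^{2m+n}\to Bar$ smooth. *)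

theory Defs
  imports "HOL-Analysis.Analysis" "HOL-Analysis.Abstract_Euclidean_Space"
    "HOL-Library.Extended_Nat" "HOL-Library.Extended_Real" "HOL-Library.Multiset"
begin

section \<open>Smooth maps between open subsets of Euclidean spaces\<close>

text \<open>
  Points of $\mathbb{R}^n$ are sequences vanishing from index $n$ on, i.e. the points of
  \<^const>\<open>Euclidean_space\<close> \<open>n\<close>; coordinates are numbered from 0. In this way the
  dimension is a term, and one can quantify over the domains of all dimensions.
\<close>

abbreviation euclid :: "nat \<Rightarrow> (nat \<Rightarrow> real) set"
  where "euclid n \<equiv> topspace (Euclidean_space n)"

definition partial_deriv :: "nat \<Rightarrow> ((nat \<Rightarrow> real) \<Rightarrow> real) \<Rightarrow> (nat \<Rightarrow> real) \<Rightarrow> real"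
  where "partial_deriv i f x = deriv (\<lambda>t. f (x(i := t))) (x i)"

text \<open>
  \<open>C_k n k U f\<close>: all partial derivatives of \<open>f\<close> of order at most \<open>k\<close> exist and are continuous
  on the open set \<open>U\<close> of $\mathbb{R}^n$.
\<close>

primrec C_k :: "nat \<Rightarrow> nat \<Rightarrow> (nat \<Rightarrow> real) set \<Rightarrow> ((nat \<Rightarrow> real) \<Rightarrow> real) \<Rightarrow> bool"
  where
    "C_k n 0 U f \<longleftrightarrow> continuous_map (subtopology (Euclidean_space n) U) euclideanreal f"
  | "C_k n (Suc k) U f \<longleftrightarrow>
       continuous_map (subtopology (Euclidean_space n) U) euclideanreal f \<and>
       (\<forall>i<n. (\<forall>x\<in>U. (\<lambda>t. f (x(i := t))) differentiable (at (x i))) \<and>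
              C_k n k U (partial_deriv i f))"

definition C_inf :: "nat \<Rightarrow> (nat \<Rightarrow> real) set \<Rightarrow> nat \<Rightarrow> ((nat \<Rightarrow> real) \<Rightarrow> nat \<Rightarrow> real) \<Rightarrow> bool"
  where "C_inf n U m f \<longleftrightarrow> f \<in> U \<rightarrow> euclid m \<and> (\<forall>j<m. \<forall>k. C_k n k U (\<lambda>x. f x j))"


section \<open>Smooth manifolds\<close>

text \<open>
  A chart is a pair \<open>(U, \<phi>)\<close>; only the values of \<open>\<phi>\<close> on \<open>U\<close> matter. The atlas need not be
  maximal: an atlas and the maximal atlas containing it have the same smooth maps.
\<close>

record 'a manifold =
  mdim :: nat
  mtop :: "'a topology"
  matlas :: "('a set \<times> ('a \<Rightarrow> nat \<Rightarrow> real)) set"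

definition smooth_manifold :: "'a manifold \<Rightarrow> bool"
  where "smooth_manifold M \<longleftrightarrow>
    Hausdorff_space (mtop M) \<and> second_countable (mtop M) \<and>
    (\<Union>(U, \<phi>)\<in>matlas M. U) = topspace (mtop M) \<and>
    (\<forall>(U, \<phi>)\<in>matlas M. openin (mtop M) U \<and>
       openin (Euclidean_space (mdim M)) (\<phi> ` U) \<and>
       homeomorphic_map (subtopology (mtop M) U)
         (subtopology (Euclidean_space (mdim M)) (\<phi> ` U)) \<phi>) \<and>
    (\<forall>(U, \<phi>)\<in>matlas M. \<forall>(V, \<psi>)\<in>matlas M.
       C_inf (mdim M) (\<phi> ` (U \<inter> V)) (mdim M) (\<psi> \<circ> inv_into U \<phi>))"

definition smooth_map :: "'a manifold \<Rightarrow> 'b manifold \<Rightarrow> ('a \<Rightarrow> 'b) \<Rightarrow> bool"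
  where "smooth_map M N f \<longleftrightarrow>
    continuous_map (mtop M) (mtop N) f \<and>
    (\<forall>(U, \<phi>)\<in>matlas M. \<forall>(V, \<psi>)\<in>matlas N.
       C_inf (mdim M) (\<phi> ` (U \<inter> f -` V)) (mdim N) (\<psi> \<circ> f \<circ> inv_into U \<phi>))"

definition open_submanifold :: "'a manifold \<Rightarrow> 'a set \<Rightarrow> 'a manifold"
  where "open_submanifold M W =
    \<lparr>mdim = mdim M, mtop = subtopology (mtop M) W,
     matlas = (\<lambda>(U, \<phi>). (U \<inter> W, \<phi>)) ` matlas M\<rparr>"

definition euclid_manifold :: "nat \<Rightarrow> (nat \<Rightarrow> real) manifold"
  where "euclid_manifold n =
    \<lparr>mdim = n, mtop = Euclidean_space n, matlas = {(euclid n, \<lambda>x. x)}\<rparr>"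


section \<open>Diffeologies\<close>

text \<open>
  A map \<open>P\<close> from an open subset \<open>U\<close> of $\mathbb{R}^n$ to a set is the triple \<open>(n, U, P)\<close> with \<open>P\<close>
  extensional on \<open>U\<close>, so that maps that agree on their domain are equal and inclusion of
  diffeologies is inclusion of sets. A diffeology is the set of its plots.
\<close>

type_synonym 's plots = "(nat \<times> (nat \<Rightarrow> real) set \<times> ((nat \<Rightarrow> real) \<Rightarrow> 's)) set"

definition all_parametrizations :: "'s set \<Rightarrow> 's plots"
  where "all_parametrizations S = {(n, U, P). openin (Euclidean_space n) U \<and> P \<in> U \<rightarrow>\<^sub>E S}"

definition diffeology :: "'s set \<Rightarrow> 's plots \<Rightarrow> bool"
  where "diffeology S D \<longleftrightarrow>
    S \<noteq> {} \<and> D \<subseteq> all_parametrizations S \<and>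
    (\<forall>n. \<forall>s\<in>S. (n, euclid n, \<lambda>x\<in>euclid n. s) \<in> D) \<and>
    (\<forall>(n, U, P)\<in>all_parametrizations S.
       (\<forall>x\<in>U. \<exists>V. openin (Euclidean_space n) V \<and> x \<in> V \<and> V \<subseteq> U \<and> (n, V, restrict P V) \<in> D)
       \<longrightarrow> (n, U, P) \<in> D) \<and>
    (\<forall>(n, U, P)\<in>D. \<forall>k W F. openin (Euclidean_space k) W \<and> C_inf k W n F \<and> F ` W \<subseteq> U
       \<longrightarrow> (k, W, compose W P F) \<in> D)"

definition diffeological_maps :: "'s set \<Rightarrow> 's plots \<Rightarrow> 't set \<Rightarrow> 't plots \<Rightarrow> ('s \<Rightarrow> 't) set"
  where "diffeological_maps S D T E =
    {f \<in> S \<rightarrow>\<^sub>E T. \<forall>(n, U, P)\<in>D. (n, U, compose U f P) \<in> E}"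

definition euclid_diffeology :: "nat \<Rightarrow> (nat \<Rightarrow> real) plots"
  where "euclid_diffeology k =
    {(n, U, P). openin (Euclidean_space n) U \<and> P \<in> extensional U \<and> C_inf n U k P}"

definition manifold_diffeology :: "'a manifold \<Rightarrow> 'a plots"
  where "manifold_diffeology M =
    {(n, U, P). openin (Euclidean_space n) U \<and> P \<in> extensional U \<and>
                smooth_map (open_submanifold (euclid_manifold n) U) M P}"

text \<open>\<open>LEAST\<close> is with respect to inclusion, so it picks out the finest diffeology.\<close>

definition sum_diffeology :: "'i set \<Rightarrow> ('i \<Rightarrow> 's set) \<Rightarrow> ('i \<Rightarrow> 's plots) \<Rightarrow> ('i \<times> 's) plots"
  where "sum_diffeology I X D = (LEAST E. diffeology (Sigma I X) E \<and>
    (\<forall>i\<in>I. restrict (Pair i) (X i) \<in> diffeological_maps (X i) (D i) (Sigma I X) E))"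

definition quotient_diffeology :: "'s set \<Rightarrow> 's plots \<Rightarrow> 't set \<Rightarrow> ('s \<Rightarrow> 't) \<Rightarrow> 't plots"
  where "quotient_diffeology S D T q = (LEAST E. diffeology T E \<and>
    restrict q S \<in> diffeological_maps S D T E)"


section \<open>Barcodes\<close>

text \<open>Multisets with possibly infinite multiplicities are represented by multiplicity functions.\<close>

type_synonym barcode = "real \<times> ereal \<Rightarrow> enat"

definition barcode_of :: "(real \<times> ereal) multiset \<Rightarrow> barcode"
  where "barcode_of D' = (\<lambda>p. enat (count D' p) + (if p \<in> range (\<lambda>b. (b, ereal b)) then \<infinity> else 0))"

definition Bar :: "barcode set"
  where "Bar = {barcode_of D' |D'. \<forall>(b, d)\<in>#D'. d \<noteq> -\<infinity>}"

text \<open>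
  The coordinates of $\mathbb{R}^{2m}\times\mathbb{R}^n = \mathbb{R}^{2m+n}$ are
  $b_1, d_1, \dots, b_m, d_m, v_1, \dots, v_n$, in this order.
\<close>

definition Q :: "nat \<Rightarrow> nat \<Rightarrow> (nat \<Rightarrow> real) \<Rightarrow> barcode"
  where "Q m n x = barcode_of
    (image_mset (\<lambda>i. (x (2 * i), ereal (x (2 * i + 1)))) (mset_set {..<m}) +
     image_mset (\<lambda>j. (x (2 * m + j), \<infinity>)) (mset_set {..<n}))"

definition ordered_barcodes :: "((nat \<times> nat) \<times> (nat \<Rightarrow> real)) set"
  where "ordered_barcodes = (SIGMA (m, n):UNIV. euclid (2 * m + n))"

definition ordered_barcode_diffeology :: "((nat \<times> nat) \<times> (nat \<Rightarrow> real)) plots"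
  where "ordered_barcode_diffeology =
    sum_diffeology UNIV (\<lambda>(m, n). euclid (2 * m + n)) (\<lambda>(m, n). euclid_diffeology (2 * m + n))"

text \<open>
  By \<open>Q_image\<close> below, the maps \<open>Q m n\<close> induce a bijection from the quotient of
  \<^const>\<open>ordered_barcodes\<close> by equality of images to \<^const>\<open>Bar\<close>. Under this identification
  \<open>\<lambda>((m, n), x). Q m n x\<close> is the quotient map.
\<close>

definition canonical_diffeology :: "barcode plots"
  where "canonical_diffeology =
    quotient_diffeology ordered_barcodes ordered_barcode_diffeology Bar (\<lambda>((m, n), x). Q m n x)"

definition inf_differentiable_at :: "'a manifold \<Rightarrow> ('a \<Rightarrow> barcode) \<Rightarrow> 'a \<Rightarrow> bool"
  where "inf_differentiable_at M B x \<longleftrightarrow>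
    (\<exists>U m n B'. openin (mtop M) U \<and> x \<in> U \<and>
       smooth_map (open_submanifold M U) (euclid_manifold (2 * m + n)) B' \<and>
       (\<forall>y\<in>U. B y = Q m n (B' y)))"


section \<open>The finest diffeologies above exist\<close>

lemma diffeologyI:
  assumes "S \<noteq> {}" "D \<subseteq> all_parametrizations S"
    and "\<And>n s. s \<in> S \<Longrightarrow> (n, euclid n, \<lambda>x\<in>euclid n. s) \<in> D"
    and "\<And>n U P. (n, U, P) \<in> all_parametrizations S \<Longrightarrow>
      (\<And>x. x \<in> U \<Longrightarrow> \<exists>V. openin (Euclidean_space n) V \<and> x \<in> V \<and> V \<subseteq> U \<and> (n, V, restrict P V) \<in> D) \<Longrightarrow>
      (n, U, P) \<in> D"
    and "\<And>n U P k W F. (n, U, P) \<in> D \<Longrightarrow> openin (Euclidean_space k) W \<Longrightarrow> C_inf k W n F \<Longrightarrow>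
      F ` W \<subseteq> U \<Longrightarrow> (k, W, compose W P F) \<in> D"
  shows "diffeology S D"
  unfolding diffeology_def
proof (intro conjI)
  show "\<forall>(n, U, P)\<in>all_parametrizations S.
       (\<forall>x\<in>U. \<exists>V. openin (Euclidean_space n) V \<and> x \<in> V \<and> V \<subseteq> U \<and> (n, V, restrict P V) \<in> D)
       \<longrightarrow> (n, U, P) \<in> D"
    by clarify (rule assms(4); blast)
  show "\<forall>(n, U, P)\<in>D. \<forall>k W F. openin (Euclidean_space k) W \<and> C_inf k W n F \<and> F ` W \<subseteq> U
       \<longrightarrow> (k, W, compose W P F) \<in> D"
    by clarify (rule assms(5))
qed (use assms(1-3) in simp_all)

lemma diffeologyD:
  assumes "diffeology S D"
  shows "S \<noteq> {}" "D \<subseteq> all_parametrizations S"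
    and "\<And>n s. s \<in> S \<Longrightarrow> (n, euclid n, \<lambda>x\<in>euclid n. s) \<in> D"
    and "\<And>n U P. (n, U, P) \<in> all_parametrizations S \<Longrightarrow>
      (\<And>x. x \<in> U \<Longrightarrow> \<exists>V. openin (Euclidean_space n) V \<and> x \<in> V \<and> V \<subseteq> U \<and> (n, V, restrict P V) \<in> D) \<Longrightarrow>
      (n, U, P) \<in> D"
    and "\<And>n U P k W F. (n, U, P) \<in> D \<Longrightarrow> openin (Euclidean_space k) W \<Longrightarrow> C_inf k W n F \<Longrightarrow>
      F ` W \<subseteq> U \<Longrightarrow> (k, W, compose W P F) \<in> D"
proof -
  note * = assms[unfolded diffeology_def]
  show "S \<noteq> {}" "D \<subseteq> all_parametrizations S"
    "\<And>n s. s \<in> S \<Longrightarrow> (n, euclid n, \<lambda>x\<in>euclid n. s) \<in> D"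
    using * by simp_all
  show "(n, U, P) \<in> D" if "(n, U, P) \<in> all_parametrizations S"
    "\<And>x. x \<in> U \<Longrightarrow> \<exists>V. openin (Euclidean_space n) V \<and> x \<in> V \<and> V \<subseteq> U \<and> (n, V, restrict P V) \<in> D"
    for n U P
    using *[THEN conjunct2, THEN conjunct2, THEN conjunct2, THEN conjunct1, THEN bspec, OF that(1)] that(2)
    by simp
  show "(k, W, compose W P F) \<in> D" if "(n, U, P) \<in> D" "openin (Euclidean_space k) W"
    "C_inf k W n F" "F ` W \<subseteq> U" for n U P k W F
    using *[THEN conjunct2, THEN conjunct2, THEN conjunct2, THEN conjunct2, THEN bspec, OF that(1)] that(2-4)
    by simp
qed

lemma diffeology_all_parametrizations:
  assumes "S \<noteq> {}"
  shows "diffeology S (all_parametrizations S)"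
proof (rule diffeologyI)
  show "(k, W, compose W P F) \<in> all_parametrizations S"
    if "(n, U, P) \<in> all_parametrizations S" "openin (Euclidean_space k) W" "F ` W \<subseteq> U"
    for n U P k W F
  proof -
    have "P (F x) \<in> S" if "x \<in> W" for x
      using that \<open>(n, U, P) \<in> _\<close> \<open>F ` W \<subseteq> U\<close> by (auto simp: all_parametrizations_def)
    then show ?thesis
      using that by (simp add: all_parametrizations_def compose_def)
  qed
qed (use assms in \<open>simp_all add: all_parametrizations_def\<close>)

lemma diffeology_Inter:
  assumes ne: "\<D> \<noteq> {}" and D: "\<And>D. D \<in> \<D> \<Longrightarrow> diffeology S D"
  shows "diffeology S (\<Inter>\<D>)"
proof (rule diffeologyI)
  obtain D\<^sub>0 where D0: "D\<^sub>0 \<in> \<D>"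
    using ne by blast
  show "S \<noteq> {}" "\<Inter>\<D> \<subseteq> all_parametrizations S"
    using diffeologyD(1,2)[OF D[OF D0]] D0 by blast+
  show "(n, euclid n, \<lambda>x\<in>euclid n. s) \<in> \<Inter>\<D>" if "s \<in> S" for n s
    using diffeologyD(3)[OF D that] by simp
  show "(n, U, P) \<in> \<Inter>\<D>"
    if P: "(n, U, P) \<in> all_parametrizations S"
      and loc: "\<And>x. x \<in> U \<Longrightarrow> \<exists>V. openin (Euclidean_space n) V \<and> x \<in> V \<and> V \<subseteq> U \<and> (n, V, restrict P V) \<in> \<Inter>\<D>"
    for n U P
  proof
    fix D' assume D': "D' \<in> \<D>"
    show "(n, U, P) \<in> D'"
    proof (rule diffeologyD(4)[OF D[OF D'] P])
      fix x assume "x \<in> U"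
      then show "\<exists>V. openin (Euclidean_space n) V \<and> x \<in> V \<and> V \<subseteq> U \<and> (n, V, restrict P V) \<in> D'"
        using loc D' by (meson InterD)
    qed
  qed
  show "(k, W, compose W P F) \<in> \<Inter>\<D>"
    if "(n, U, P) \<in> \<Inter>\<D>" "openin (Euclidean_space k) W" "C_inf k W n F" "F ` W \<subseteq> U"
    for n U P k W F
    using diffeologyD(5)[OF D _ that(2-4)] that(1) by simp
qed

lemma finest_diffeology_exists:
  assumes "S \<noteq> {}" and "\<Phi> (all_parametrizations S)"
    and Inter: "\<And>\<D>. \<D> \<noteq> {} \<Longrightarrow> (\<And>D. D \<in> \<D> \<Longrightarrow> \<Phi> D) \<Longrightarrow> \<Phi> (\<Inter>\<D>)"
  defines "E \<equiv> (LEAST E. diffeology S E \<and> \<Phi> E)"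
  shows "diffeology S E \<and> \<Phi> E \<and> (\<forall>E'. diffeology S E' \<and> \<Phi> E' \<longrightarrow> E \<subseteq> E')"
proof -
  let ?\<D> = "{E. diffeology S E \<and> \<Phi> E}"
  have "?\<D> \<noteq> {}"
    using assms diffeology_all_parametrizations by blast
  then have *: "diffeology S (\<Inter>?\<D>)" "\<Phi> (\<Inter>?\<D>)"
    using diffeology_Inter[of ?\<D> S] Inter[of ?\<D>] by blast+
  have "E = \<Inter>?\<D>"
    unfolding E_def by (rule Least_equality) (use * in blast)+
  with * show ?thesis by blast
qed

lemma diffeological_maps_all_parametrizations:
  assumes "D \<subseteq> all_parametrizations S" "f \<in> S \<rightarrow>\<^sub>E T"
  shows "f \<in> diffeological_maps S D T (all_parametrizations T)"
proof -
  have "(n, U, compose U f P) \<in> all_parametrizations T" if "(n, U, P) \<in> D" for n U P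
  proof -
    have "openin (Euclidean_space n) U" "P \<in> U \<rightarrow> S"
      using that assms(1) by (auto simp: all_parametrizations_def)
    moreover have "f (P x) \<in> T" if "x \<in> U" for x
      using that \<open>P \<in> U \<rightarrow> S\<close> assms(2) by auto
    ultimately show ?thesis
      by (simp add: all_parametrizations_def compose_def)
  qed
  then show ?thesis
    using assms(2) by (simp add: diffeological_maps_def split_beta)
qed

lemma diffeological_maps_Inter:
  assumes "\<D> \<noteq> {}" "\<And>E. E \<in> \<D> \<Longrightarrow> f \<in> diffeological_maps S D T E"
  shows "f \<in> diffeological_maps S D T (\<Inter>\<D>)"
  using assms by (auto simp: diffeological_maps_def split_beta)

lemma sum_diffeology_finest:
  assumes "Sigma I X \<noteq> {}" "\<And>i. i \<in> I \<Longrightarrow> D i \<subseteq> all_parametrizations (X i)"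
  defines "\<Phi> \<equiv> \<lambda>E. \<forall>i\<in>I. restrict (Pair i) (X i) \<in> diffeological_maps (X i) (D i) (Sigma I X) E"
  shows "diffeology (Sigma I X) (sum_diffeology I X D) \<and> \<Phi> (sum_diffeology I X D) \<and>
    (\<forall>E. diffeology (Sigma I X) E \<and> \<Phi> E \<longrightarrow> sum_diffeology I X D \<subseteq> E)"
proof -
  have "\<Phi> (all_parametrizations (Sigma I X))"
    unfolding \<Phi>_def using assms(2) by (auto intro!: diffeological_maps_all_parametrizations)
  moreover have "\<Phi> (\<Inter>\<D>)" if "\<D> \<noteq> {}" "\<And>E. E \<in> \<D> \<Longrightarrow> \<Phi> E" for \<D>
    using that unfolding \<Phi>_def by (auto intro!: diffeological_maps_Inter)
  ultimately show ?thesis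
    using finest_diffeology_exists[of "Sigma I X" \<Phi>] assms(1)
    unfolding sum_diffeology_def \<Phi>_def by blast
qed

lemma quotient_diffeology_finest:
  assumes "T \<noteq> {}" "D \<subseteq> all_parametrizations S" "q \<in> S \<rightarrow> T"
  defines "\<Phi> \<equiv> \<lambda>E. restrict q S \<in> diffeological_maps S D T E"
  shows "diffeology T (quotient_diffeology S D T q) \<and> \<Phi> (quotient_diffeology S D T q) \<and>
    (\<forall>E. diffeology T E \<and> \<Phi> E \<longrightarrow> quotient_diffeology S D T q \<subseteq> E)"
proof -
  have "\<Phi> (all_parametrizations T)"
    unfolding \<Phi>_def using assms(2,3) by (intro diffeological_maps_all_parametrizations) auto
  moreover have "\<Phi> (\<Inter>\<D>)" if "\<D> \<noteq> {}" "\<And>E. E \<in> \<D> \<Longrightarrow> \<Phi> E" for \<D>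
    using that unfolding \<Phi>_def by (auto intro!: diffeological_maps_Inter)
  ultimately show ?thesis
    using finest_diffeology_exists[of T \<Phi>] assms(1)
    unfolding quotient_diffeology_def \<Phi>_def by blast
qed

lemma Q_in_Bar: "Q m n x \<in> Bar"
  unfolding Q_def Bar_def by fastforce

lemma Q_image: "(\<lambda>((m, n), x). Q m n x) ` ordered_barcodes = Bar"
proof
  show "(\<lambda>((m, n), x). Q m n x) ` ordered_barcodes \<subseteq> Bar"
    by (auto simp: Q_in_Bar)
  show "Bar \<subseteq> (\<lambda>((m, n), x). Q m n x) ` ordered_barcodes"
  proof
    fix B assume "B \<in> Bar"
    then obtain D where B: "B = barcode_of D" and D: "\<forall>(b, d)\<in>#D. d \<noteq> -\<infinity>"
      unfolding Bar_def by blast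
    obtain fs where fs: "mset fs = filter_mset (\<lambda>p. snd p \<noteq> \<infinity>) D"
      using ex_mset by blast
    obtain gs where gs: "mset gs = filter_mset (\<lambda>p. snd p = \<infinity>) D"
      using ex_mset by blast
    define m n where "m = length fs" and "n = length gs"
    define x where "x = (\<lambda>i. if i < 2 * m
        then (if even i then fst (fs ! (i div 2)) else real_of_ereal (snd (fs ! (i div 2))))
        else if i < 2 * m + n then fst (gs ! (i - 2 * m)) else 0)"
    have f: "(x (2 * i), ereal (x (2 * i + 1))) = fs ! i" if "i < m" for i
    proof -
      have "fs ! i \<in># mset fs"
        using that by (simp add: m_def)
      then have "snd (fs ! i) \<noteq> \<infinity>" "snd (fs ! i) \<noteq> -\<infinity>"
        using D unfolding fs by auto
      then show ?thesis
        using that by (auto simp: x_def prod_eq_iff ereal_real)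
    qed
    have g: "(x (2 * m + j), \<infinity>) = gs ! j" if "j < n" for j
    proof -
      have "gs ! j \<in># mset gs"
        using that by (simp add: n_def)
      then have "snd (gs ! j) = \<infinity>"
        unfolding gs by auto
      then show ?thesis
        using that by (auto simp: x_def prod_eq_iff)
    qed
    have nths: "image_mset (\<lambda>i. xs ! i) (mset_set {..<length xs}) = mset xs"
      for xs :: "(real \<times> ereal) list"
      by (metis atLeast_upt map_nth mset_map mset_upt lessThan_atLeast0)
    have "image_mset (\<lambda>i. (x (2 * i), ereal (x (2 * i + 1)))) (mset_set {..<m}) = mset fs"
      using f nths[of fs] by (metis (no_types, lifting) finite_lessThan finite_set_mset_mset_set
          image_mset_cong lessThan_iff m_def)
    moreover have "image_mset (\<lambda>j. (x (2 * m + j), \<infinity>)) (mset_set {..<n}) = mset gs"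
      using g nths[of gs] by (metis (no_types, lifting) finite_lessThan finite_set_mset_mset_set
          image_mset_cong lessThan_iff n_def)
    moreover have "mset fs + mset gs = D"
      unfolding fs gs using multiset_partition[of D "\<lambda>p. snd p \<noteq> \<infinity>"] by simp
    ultimately have "B = Q m n x"
      by (simp add: B Q_def)
    moreover have "((m, n), x) \<in> ordered_barcodes"
      by (auto simp: ordered_barcodes_def topspace_Euclidean_space x_def)
    ultimately show "B \<in> (\<lambda>((m, n), x). Q m n x) ` ordered_barcodes"
      by force
  qed
qed

lemma ordered_barcode_diffeology: "diffeology ordered_barcodes ordered_barcode_diffeology"
proof -
  let ?X = "\<lambda>(m, n). euclid (2 * m + n)"
  let ?D = "\<lambda>(m, n). euclid_diffeology (2 * m + n)"
  have "((0, 0), \<lambda>_. 0) \<in> Sigma UNIV ?X"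
    by (simp add: topspace_Euclidean_space)
  then have "Sigma UNIV ?X \<noteq> {}"
    by blast
  moreover have "euclid_diffeology k \<subseteq> all_parametrizations (euclid k)" for k
    unfolding euclid_diffeology_def all_parametrizations_def C_inf_def by (auto simp: PiE_def)
  then have "?D i \<subseteq> all_parametrizations (?X i)" for i
    by (simp only: split_beta)
  ultimately have "diffeology (Sigma UNIV ?X) (sum_diffeology UNIV ?X ?D)"
    by (intro conjunct1[OF sum_diffeology_finest])
  then show ?thesis
    unfolding ordered_barcode_diffeology_def ordered_barcodes_def .
qed

lemma canonical_diffeology: "diffeology Bar canonical_diffeology"
proof -
  have "Bar \<noteq> {}"
    using Q_in_Bar by blast
  moreover have "(\<lambda>((m, n), x). Q m n x) \<in> ordered_barcodes \<rightarrow> Bar"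
    by (auto simp: Q_in_Bar)
  ultimately show ?thesis
    unfolding canonical_diffeology_def
    by (intro conjunct1[OF quotient_diffeology_finest] diffeologyD(2)[OF ordered_barcode_diffeology])
qed

end

theory Submission
  imports Defs
begin

text \<open>
  The canonical diffeology of the space of barcodes has a concrete description: its plots are the
  maps from a domain to the space of barcodes that near every point have the form \<open>Q m n \<circ> F\<close>, with
  \<open>F\<close> smooth into $\mathbb{R}^{2m+n}$ (\<open>canonical_diffeology_eq\<close>). Indeed these maps form a diffeology,
  because smooth maps compose, and every diffeology for which the maps \<open>Q m n\<close> are smooth contains
  them, because being a plot is a local property. The same reasoning describes the sum diffeology,
  whose plots locally take values in a single summand.

  Hence a map \<open>B\<close> on a manifold that is smooth for the diffeologies is $\infty$-differentiable: the
  inverse of a chart is a plot, so \<open>B\<close> composed with it locally lifts to some $\mathbb{R}^{2m+n}$, and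
  composing the lift with the chart gives a lift of \<open>B\<close>. Conversely, composing local lifts of \<open>B\<close>
  with a plot of the manifold gives local lifts of the composition of \<open>B\<close> with the plot.

  Both directions, and already the description of the canonical diffeology, rest on the fact that
  compositions of smooth maps are smooth. As smoothness is defined by iterated partial derivatives,
  this needs a chain rule for functions with continuous partial derivatives
  (\<open>has_derivative_along_curve\<close>) and an induction on the order of differentiability
  (\<open>C_k_compose\<close>).
\<close>

section \<open>Functions with continuous partial derivatives\<close>

lemma openin_Euclidean_space_subset:
  "openin (Euclidean_space n) U \<Longrightarrow> U \<subseteq> euclid n"
  by (rule openin_subset)

text \<open>
  Open sets are handled through the boxes they contain, since the arguments below move one
  coordinate at a time and the type of sequences does not carry the Euclidean norm.
\<close>

lemma openin_Euclidean_space_box: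
  assumes "openin (Euclidean_space n) U" "x \<in> U"
  obtains d where "d > 0" "\<And>y. y \<in> euclid n \<Longrightarrow> (\<And>i. i < n \<Longrightarrow> \<bar>y i - x i\<bar> < d) \<Longrightarrow> y \<in> U"
proof -
  obtain T where T: "openin (powertop_real UNIV) T" and U: "U = T \<inter> {x. \<forall>i\<ge>n. x i = 0}"
    using assms(1) unfolding Euclidean_space_def openin_subtopology by blast
  have "x \<in> T"
    using assms(2) U by blast
  from bspec[OF T[unfolded openin_product_topology_alt] this]
  obtain X where X: "\<And>i. open (X i)" "x \<in> Pi\<^sub>E UNIV X" "Pi\<^sub>E UNIV X \<subseteq> T"
    by (auto simp del: PiE_UNIV_domain)
  have "\<exists>e>0. \<forall>t. \<bar>t - x i\<bar> < e \<longrightarrow> t \<in> X i" for i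
    using X(1)[of i] PiE_mem[OF X(2) UNIV_I, of i] by (auto simp: open_dist dist_real_def)
  then obtain e where e: "\<And>i. e i > 0" "\<And>i t. \<bar>t - x i\<bar> < e i \<Longrightarrow> t \<in> X i"
    by metis
  define d where "d = Min (insert 1 (e ` {..<n}))"
  show thesis
  proof (rule that[of d])
    show "d > 0"
      using e(1) by (auto simp: d_def)
    fix y assume y: "y \<in> euclid n" "\<And>i. i < n \<Longrightarrow> \<bar>y i - x i\<bar> < d"
    have "y i \<in> X i" for i
    proof (cases "i < n")
      case True
      then have "d \<le> e i"
        by (simp add: d_def)
      with y(2)[OF True] show ?thesis
        by (intro e(2)) simp
    next
      case False
      then have "y i = x i"
        using y(1) assms(2) U by (simp add: topspace_Euclidean_space)
      then show ?thesis
        using X(2) by auto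
    qed
    then show "y \<in> U"
      using X(3) y(1) U by (auto simp: topspace_Euclidean_space PiE_UNIV_domain)
  qed
qed

lemma eventually_fun_upd_mem_open:
  assumes "openin (Euclidean_space n) U" "x \<in> U" "i < n"
  shows "eventually (\<lambda>t. x(i := t) \<in> U) (nhds (x i))"
proof -
  obtain d where d: "d > 0" "\<And>y. y \<in> euclid n \<Longrightarrow> (\<And>i. i < n \<Longrightarrow> \<bar>y i - x i\<bar> < d) \<Longrightarrow> y \<in> U"
    using openin_Euclidean_space_box[OF assms(1,2)] by metis
  have "x \<in> euclid n"
    using assms openin_Euclidean_space_subset by blast
  then have "x(i := t) \<in> U" if "dist t (x i) < d" for t
    using that assms(3) d(1) by (intro d(2)) (auto simp: topspace_Euclidean_space dist_real_def)
  then show ?thesis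
    using d(1) by (auto simp: eventually_nhds_metric)
qed

lemma continuous_map_Euclidean_subspace_box:
  assumes "openin (Euclidean_space n) U" "x \<in> U" "e > 0"
    and cont: "continuous_map (subtopology (Euclidean_space n) U) euclideanreal f"
  obtains d where "d > 0"
    "\<And>y. y \<in> euclid n \<Longrightarrow> (\<And>i. i < n \<Longrightarrow> \<bar>y i - x i\<bar> < d) \<Longrightarrow> y \<in> U \<and> \<bar>f y - f x\<bar> < e"
proof -
  have top: "topspace (subtopology (Euclidean_space n) U) = U"
    using openin_Euclidean_space_subset[OF assms(1)] by auto
  have "openin (subtopology (Euclidean_space n) U) {y \<in> U. f y \<in> ball (f x) e}"
    using openin_continuous_map_preimage[OF cont, of "ball (f x) e"] unfolding top by simp
  then have "openin (Euclidean_space n) {y \<in> U. f y \<in> ball (f x) e}"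
    using assms(1) by (rule openin_trans_full)
  then show thesis
    using openin_Euclidean_space_box[of n "{y \<in> U. f y \<in> ball (f x) e}" x] assms(2,3) that
    by (auto simp: dist_real_def abs_minus_commute)
qed

lemma mean_value_symmetric:
  fixes F :: "real \<Rightarrow> real"
  assumes "\<And>s. \<bar>s - a\<bar> \<le> \<bar>b - a\<bar> \<Longrightarrow> (F has_real_derivative F' s) (at s)"
  shows "\<exists>s. \<bar>s - a\<bar> \<le> \<bar>b - a\<bar> \<and> F b - F a = F' s * (b - a)"
proof (cases a b rule: linorder_cases)
  case less
  then show ?thesis
    using MVT2[of a b F F'] assms by (force simp: mult.commute)
next
  case equal
  then show ?thesis by auto
next
  case greater
  then obtain z where "b < z" "z < a" "F a - F b = (a - b) * F' z"
    using MVT2[of b a F F'] assms by force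
  then show ?thesis
    by (intro exI[of _ z]) (auto simp: algebra_simps)
qed

text \<open>
  The increment of \<open>f\<close> along the curve is split into one increment per coordinate: the point whose
  coordinates below \<open>j\<close> have already moved is compared with the one where coordinate \<open>j\<close> moves as
  well. By the mean value theorem such an increment is the increment of \<open>\<gamma>\<^sub>j\<close> times a value of the
  \<open>j\<close>-th partial derivative at a point that tends to \<open>\<gamma> t\<^sub>0\<close>, and continuity of this partial
  derivative gives the limit.
\<close>

lemma has_derivative_along_curve:
  fixes \<gamma> :: "real \<Rightarrow> nat \<Rightarrow> real"
  assumes V: "openin (Euclidean_space m) V" "\<gamma> t\<^sub>0 \<in> V"
    and euclid: "eventually (\<lambda>t. \<gamma> t \<in> euclid m) (nhds t\<^sub>0)"
    and deriv: "\<And>j. j < m \<Longrightarrow> ((\<lambda>t. \<gamma> t j) has_real_derivative \<gamma>' j) (at t\<^sub>0)"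
    and diff: "\<And>j y. j < m \<Longrightarrow> y \<in> V \<Longrightarrow> (\<lambda>s. f (y(j := s))) differentiable (at (y j))"
    and cont: "\<And>j. j < m \<Longrightarrow>
      continuous_map (subtopology (Euclidean_space m) V) euclideanreal (partial_deriv j f)"
  shows "((\<lambda>t. f (\<gamma> t)) has_real_derivative (\<Sum>j<m. partial_deriv j f (\<gamma> t\<^sub>0) * \<gamma>' j)) (at t\<^sub>0)"
proof -
  define p where "p j t = (\<lambda>i. if i < j then \<gamma> t i else \<gamma> t\<^sub>0 i)" for j t
  have \<gamma>t0: "\<gamma> t\<^sub>0 \<in> euclid m"
    using V openin_Euclidean_space_subset by blast
  have step: "((\<lambda>t. f (p (Suc j) t) - f (p j t)) has_real_derivative
      partial_deriv j f (\<gamma> t\<^sub>0) * \<gamma>' j) (at t\<^sub>0)" if j: "j < m" for j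
  proof -
    define D where "D = partial_deriv j f (\<gamma> t\<^sub>0)"
    define u where "u t = f (p (Suc j) t) - f (p j t)" for t
    \<comment> \<open>The mean value factor of the increment \<open>u t\<close>; where \<open>\<gamma>\<^sub>j\<close> does not move, \<open>u t\<close> vanishes and the
      value \<open>D\<close> is chosen so that \<open>g\<close> tends to \<open>D\<close>.\<close>
    define g where "g t = (if \<gamma> t j = \<gamma> t\<^sub>0 j then D else u t / (\<gamma> t j - \<gamma> t\<^sub>0 j))" for t
    have p_Suc: "p (Suc j) t = (p j t)(j := \<gamma> t j)" and p_j: "p j t = (p j t)(j := \<gamma> t\<^sub>0 j)" for t
      by (auto simp: p_def fun_eq_iff less_Suc_eq)
    have u: "u t = g t * (\<gamma> t j - \<gamma> t\<^sub>0 j)" for t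
    proof (cases "\<gamma> t j = \<gamma> t\<^sub>0 j")
      case True
      then have "p (Suc j) t = p j t"
        using p_Suc p_j by metis
      with True show ?thesis
        by (simp add: u_def)
    qed (simp add: g_def)
    have "(g \<longlongrightarrow> D) (at t\<^sub>0)"
    proof (rule tendstoI)
      fix e :: real assume "e > 0"
      then obtain d where d: "d > 0" "\<And>y. y \<in> euclid m \<Longrightarrow> (\<And>i. i < m \<Longrightarrow> \<bar>y i - \<gamma> t\<^sub>0 i\<bar> < d) \<Longrightarrow>
          y \<in> V \<and> \<bar>partial_deriv j f y - D\<bar> < e"
        using continuous_map_Euclidean_subspace_box[OF V _ cont[OF j], of e] unfolding D_def by metis
      have "eventually (\<lambda>t. \<forall>i\<in>{..<m}. dist (\<gamma> t i) (\<gamma> t\<^sub>0 i) < d) (at t\<^sub>0)"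
      proof (intro eventually_ball_finite ballI)
        fix i assume "i \<in> {..<m}"
        then have "((\<lambda>t. \<gamma> t i) \<longlongrightarrow> \<gamma> t\<^sub>0 i) (at t\<^sub>0)"
          using DERIV_isCont[OF deriv] by (simp add: isCont_def)
        then show "eventually (\<lambda>t. dist (\<gamma> t i) (\<gamma> t\<^sub>0 i) < d) (at t\<^sub>0)"
          using d(1) by (rule tendstoD)
      qed simp
      moreover have "eventually (\<lambda>t. \<gamma> t \<in> euclid m) (at t\<^sub>0)"
        using euclid by (simp add: eventually_nhds_conv_at)
      ultimately show "eventually (\<lambda>t. dist (g t) D < e) (at t\<^sub>0)"
      proof eventually_elim
        case (elim t)
        have near: "(p j t)(j := s) \<in> V \<and> \<bar>partial_deriv j f ((p j t)(j := s)) - D\<bar> < e"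
          if "\<bar>s - \<gamma> t\<^sub>0 j\<bar> \<le> \<bar>\<gamma> t j - \<gamma> t\<^sub>0 j\<bar>" for s
        proof (rule d(2))
          show "(p j t)(j := s) \<in> euclid m"
            using elim(2) \<gamma>t0 j by (auto simp: p_def topspace_Euclidean_space)
          show "\<bar>((p j t)(j := s)) i - \<gamma> t\<^sub>0 i\<bar> < d" if "i < m" for i
            using elim(1) j that \<open>\<bar>s - \<gamma> t\<^sub>0 j\<bar> \<le> _\<close> d(1)
            by (auto simp: p_def dist_real_def intro: le_less_trans)
        qed
        have "((\<lambda>s. f ((p j t)(j := s))) has_real_derivative partial_deriv j f ((p j t)(j := s))) (at s)"
          if "\<bar>s - \<gamma> t\<^sub>0 j\<bar> \<le> \<bar>\<gamma> t j - \<gamma> t\<^sub>0 j\<bar>" for s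
          using diff[OF j conjunct1[OF near[OF that]]]
          by (simp add: partial_deriv_def DERIV_deriv_iff_real_differentiable)
        from mean_value_symmetric[of "\<gamma> t\<^sub>0 j" "\<gamma> t j", OF this]
        obtain s where s: "\<bar>s - \<gamma> t\<^sub>0 j\<bar> \<le> \<bar>\<gamma> t j - \<gamma> t\<^sub>0 j\<bar>"
          "f ((p j t)(j := \<gamma> t j)) - f ((p j t)(j := \<gamma> t\<^sub>0 j)) =
            partial_deriv j f ((p j t)(j := s)) * (\<gamma> t j - \<gamma> t\<^sub>0 j)"
          by blast
        then have "u t = partial_deriv j f ((p j t)(j := s)) * (\<gamma> t j - \<gamma> t\<^sub>0 j)"
          using p_Suc[of t] p_j[of t] by (metis u_def)
        then have "g t = (if \<gamma> t j = \<gamma> t\<^sub>0 j then D else partial_deriv j f ((p j t)(j := s)))"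
          by (simp add: g_def)
        then show ?case
          using near[OF s(1)] \<open>e > 0\<close> by (simp add: dist_real_def)
      qed
    qed
    moreover have "((\<lambda>t. (\<gamma> t j - \<gamma> t\<^sub>0 j) / (t - t\<^sub>0)) \<longlongrightarrow> \<gamma>' j) (at t\<^sub>0)"
      using deriv[OF j] by (simp add: has_field_derivative_iff)
    ultimately have "((\<lambda>t. g t * ((\<gamma> t j - \<gamma> t\<^sub>0 j) / (t - t\<^sub>0))) \<longlongrightarrow> D * \<gamma>' j) (at t\<^sub>0)"
      by (rule tendsto_mult)
    then have "(u has_real_derivative D * \<gamma>' j) (at t\<^sub>0)"
      by (simp add: has_field_derivative_iff u)
    then show ?thesis
      unfolding u_def D_def .
  qed
  have "((\<lambda>t. f (p j t)) has_real_derivative (\<Sum>i<j. partial_deriv i f (\<gamma> t\<^sub>0) * \<gamma>' i)) (at t\<^sub>0)"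
    if "j \<le> m" for j
    using that
  proof (induction j)
    case 0
    then show ?case by (simp add: p_def)
  next
    case (Suc j)
    then show ?case
      using DERIV_add[OF Suc.IH step, of j] by simp
  qed
  from this[of m] have main: "((\<lambda>t. f (p m t)) has_real_derivative
      (\<Sum>j<m. partial_deriv j f (\<gamma> t\<^sub>0) * \<gamma>' j)) (at t\<^sub>0)"
    by simp
  have "eventually (\<lambda>t. f (p m t) = f (\<gamma> t)) (nhds t\<^sub>0)"
    using euclid
  proof eventually_elim
    case (elim t)
    have "p m t = \<gamma> t"
      using elim \<gamma>t0 by (auto simp: p_def topspace_Euclidean_space fun_eq_iff not_less)
    then show ?case by simp
  qed
  from DERIV_cong_ev[OF refl this refl] show ?thesis
    using main by blast
qed

lemma C_k_imp_continuous_map: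
  "C_k n k U f \<Longrightarrow> continuous_map (subtopology (Euclidean_space n) U) euclideanreal f"
  by (cases k) auto

lemma C_k_Suc_imp_C_k: "C_k n (Suc k) U f \<Longrightarrow> C_k n k U f"
  by (induction k arbitrary: f) auto

lemma C_k_subset:
  assumes "C_k n k U f" "V \<subseteq> U"
  shows "C_k n k V f"
  using assms(1)
proof (induction k arbitrary: f)
  case 0
  then show ?case
    using assms(2) continuous_map_from_subtopology_mono by auto
next
  case (Suc k)
  then show ?case
    using assms(2) continuous_map_from_subtopology_mono by (simp; blast)
qed

lemma C_k_Suc_has_derivative:
  assumes "C_k n (Suc k) U f" "x \<in> U" "i < n"
  shows "((\<lambda>t. f (x(i := t))) has_real_derivative partial_deriv i f x) (at (x i))"
  using assms by (simp add: partial_deriv_def DERIV_deriv_iff_real_differentiable)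

text \<open>
  Openness of the domain is essential: a partial derivative at \<open>x\<close> involves the values of the
  function at points near \<open>x\<close>, and these must lie in the set where the two functions agree.
\<close>

lemma C_k_cong_imp:
  assumes "openin (Euclidean_space n) U" "C_k n k U f" "\<And>x. x \<in> U \<Longrightarrow> f x = g x"
  shows "C_k n k U g"
  using assms(2,3)
proof (induction k arbitrary: f g)
  case 0
  have "topspace (subtopology (Euclidean_space n) U) \<subseteq> U"
    by simp
  with 0 show ?case
    by (auto intro: continuous_map_eq)
next
  case (Suc k)
  have *: "((\<lambda>t. g (x(i := t))) has_real_derivative partial_deriv i f x) (at (x i))"
    if "x \<in> U" "i < n" for x i
  proof -
    have "eventually (\<lambda>t. f (x(i := t)) = g (x(i := t))) (nhds (x i))"
      using eventually_fun_upd_mem_open[OF assms(1) that] by eventually_elim (rule Suc.prems(2))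
    from DERIV_cong_ev[OF refl this refl] show ?thesis
      using C_k_Suc_has_derivative[OF Suc.prems(1) that] by blast
  qed
  have "continuous_map (subtopology (Euclidean_space n) U) euclideanreal g"
    using C_k_imp_continuous_map[OF Suc.prems(1)] Suc.prems(2) by (auto intro: continuous_map_eq)
  moreover have "C_k n k U (partial_deriv i g)" if "i < n" for i
  proof (rule Suc.IH)
    show "C_k n k U (partial_deriv i f)"
      using Suc.prems(1) that by simp
    show "partial_deriv i f x = partial_deriv i g x" if "x \<in> U" for x
      using DERIV_imp_deriv[OF *[OF that \<open>i < n\<close>]] by (simp add: partial_deriv_def)
  qed
  ultimately show ?case
    using * by (auto simp: real_differentiable_def)
qed

text \<open>
  With this rule, derivatives can be computed by differentiation rules, without mentioning
  \<^const>\<open>partial_deriv\<close> of the function in question; it suffices to know them on the open set.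
\<close>

lemma C_k_SucI:
  assumes "openin (Euclidean_space n) U"
    and "continuous_map (subtopology (Euclidean_space n) U) euclideanreal f"
    and deriv: "\<And>i x. i < n \<Longrightarrow> x \<in> U \<Longrightarrow>
      ((\<lambda>t. f (x(i := t))) has_real_derivative f' i x) (at (x i))"
    and C_k: "\<And>i. i < n \<Longrightarrow> C_k n k U (f' i)"
  shows "C_k n (Suc k) U f"
proof -
  have "C_k n k U (partial_deriv i f)" if "i < n" for i
    using DERIV_imp_deriv[OF deriv[OF that]]
    by (intro C_k_cong_imp[OF assms(1) C_k[OF that]]) (simp add: partial_deriv_def)
  then show ?thesis
    using assms(2) deriv by (auto simp: real_differentiable_def)
qed

lemma C_k_const: "C_k n k U (\<lambda>_. c)"
proof (induction k arbitrary: c)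
  case (Suc k)
  then show ?case by (simp add: partial_deriv_def[abs_def])
qed simp

lemma C_k_add:
  assumes "openin (Euclidean_space n) U" "C_k n k U f" "C_k n k U g"
  shows "C_k n k U (\<lambda>x. f x + g x)"
  using assms(2,3)
proof (induction k arbitrary: f g)
  case 0
  then show ?case by (auto intro: continuous_map_add)
next
  case (Suc k)
  show ?case
  proof (rule C_k_SucI[OF assms(1)])
    show "continuous_map (subtopology (Euclidean_space n) U) euclideanreal (\<lambda>x. f x + g x)"
      using Suc.prems by (intro continuous_map_add) auto
    show "((\<lambda>t. f (x(i := t)) + g (x(i := t))) has_real_derivative
        partial_deriv i f x + partial_deriv i g x) (at (x i))" if "i < n" "x \<in> U" for i x
      using Suc.prems that by (intro DERIV_add C_k_Suc_has_derivative)
    show "C_k n k U (\<lambda>x. partial_deriv i f x + partial_deriv i g x)" if "i < n" for i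
      using Suc that by simp
  qed
qed

lemma C_k_mult:
  assumes "openin (Euclidean_space n) U" "C_k n k U f" "C_k n k U g"
  shows "C_k n k U (\<lambda>x. f x * g x)"
  using assms(2,3)
proof (induction k arbitrary: f g)
  case 0
  then show ?case by (auto intro: continuous_map_real_mult)
next
  case (Suc k)
  show ?case
  proof (rule C_k_SucI[OF assms(1)])
    show "continuous_map (subtopology (Euclidean_space n) U) euclideanreal (\<lambda>x. f x * g x)"
      using Suc.prems by (intro continuous_map_real_mult) auto
    show "((\<lambda>t. f (x(i := t)) * g (x(i := t))) has_real_derivative
        partial_deriv i f x * g x + partial_deriv i g x * f x) (at (x i))" if "i < n" "x \<in> U" for i x
      using DERIV_mult[OF C_k_Suc_has_derivative[OF Suc.prems(1) that(2,1)]
          C_k_Suc_has_derivative[OF Suc.prems(2) that(2,1)]] by (simp only: fun_upd_triv)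
    show "C_k n k U (\<lambda>x. partial_deriv i f x * g x + partial_deriv i g x * f x)" if "i < n" for i
      using Suc.prems C_k_Suc_imp_C_k that
      by (intro C_k_add[OF assms(1)] Suc.IH) auto
  qed
qed

lemma C_k_sum:
  assumes "openin (Euclidean_space n) U" "\<And>j. j \<in> J \<Longrightarrow> C_k n k U (f j)"
  shows "C_k n k U (\<lambda>x. \<Sum>j\<in>J. f j x)"
  using assms(2)
proof (induction J rule: infinite_finite_induct)
  case (insert j J)
  then show ?case
    using C_k_add[OF assms(1), of k "f j" "\<lambda>x. \<Sum>j\<in>J. f j x"] by simp
qed (simp_all add: C_k_const)

lemma continuous_map_Euclidean_spaceI:
  assumes "f \<in> topspace X \<rightarrow> euclid m" "\<And>j. j < m \<Longrightarrow> continuous_map X euclideanreal (\<lambda>x. f x j)"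
  shows "continuous_map X (Euclidean_space m) f"
proof (rule continuous_map_eq)
  show "continuous_map X (Euclidean_space m) (\<lambda>x j. if j < m then f x j else 0)"
    using assms(2) by (simp add: continuous_map_componentwise_Euclidean_space)
  show "(\<lambda>j. if j < m then f x j else 0) = f x" if "x \<in> topspace X" for x
    using funcset_mem[OF assms(1) that] by (auto simp: topspace_Euclidean_space fun_eq_iff)
qed

text \<open>
  By the chain rule, the partial derivatives of \<open>f \<circ> g\<close> are sums of products of functions
  \<open>\<partial>\<^sub>j f \<circ> g\<close> and partial derivatives of \<open>g\<close>; the former are of class $C^k$ by induction
  when \<open>f\<close> and \<open>g\<close> are of class $C^{k+1}$.
\<close>

lemma C_k_compose:
  assumes U: "openin (Euclidean_space n) U" and V: "openin (Euclidean_space m) V"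
    and g: "g \<in> U \<rightarrow> V" "\<And>j. j < m \<Longrightarrow> C_k n k U (\<lambda>x. g x j)" and f: "C_k m k V f"
  shows "C_k n k U (\<lambda>x. f (g x))"
proof -
  have cont: "continuous_map (subtopology (Euclidean_space n) U) euclideanreal (\<lambda>x. f (g x))"
    if f: "continuous_map (subtopology (Euclidean_space m) V) euclideanreal f"
      and g': "\<And>j. j < m \<Longrightarrow> continuous_map (subtopology (Euclidean_space n) U) euclideanreal (\<lambda>x. g x j)"
    for f :: "(nat \<Rightarrow> real) \<Rightarrow> real"
  proof -
    have "continuous_map (subtopology (Euclidean_space n) U) (Euclidean_space m) g"
      using g(1) openin_Euclidean_space_subset[OF V] g'
      by (intro continuous_map_Euclidean_spaceI) auto
    then have "continuous_map (subtopology (Euclidean_space n) U) (subtopology (Euclidean_space m) V) g"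
      using g(1) by (auto simp: continuous_map_in_subtopology)
    from continuous_map_compose[OF this f] show ?thesis
      by (simp add: o_def)
  qed
  show ?thesis
    using f g(2)
  proof (induction k arbitrary: f)
    case 0
    then show ?case by (simp add: cont)
  next
    case (Suc k)
    show ?case
    proof (rule C_k_SucI[OF U])
      show "continuous_map (subtopology (Euclidean_space n) U) euclideanreal (\<lambda>x. f (g x))"
        by (rule cont[OF C_k_imp_continuous_map[OF Suc.prems(1)] C_k_imp_continuous_map[OF Suc.prems(2)]])
      show "((\<lambda>t. f (g (x(i := t)))) has_real_derivative
          (\<Sum>j<m. partial_deriv j f (g x) * partial_deriv i (\<lambda>x. g x j) x)) (at (x i))"
        if "i < n" "x \<in> U" for i x
      proof -
        have "((\<lambda>t. f (g (x(i := t)))) has_real_derivative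
            (\<Sum>j<m. partial_deriv j f (g (x(i := x i))) * partial_deriv i (\<lambda>x. g x j) x)) (at (x i))"
        proof (rule has_derivative_along_curve[OF V])
          show "g (x(i := x i)) \<in> V"
            using g(1) that by auto
          show "eventually (\<lambda>t. g (x(i := t)) \<in> euclid m) (nhds (x i))"
            using eventually_fun_upd_mem_open[OF U that(2,1)]
            by eventually_elim (use g(1) openin_Euclidean_space_subset[OF V] in auto)
          show "((\<lambda>t. g (x(i := t)) j) has_real_derivative partial_deriv i (\<lambda>x. g x j) x) (at (x i))"
            if "j < m" for j
            by (rule C_k_Suc_has_derivative[OF Suc.prems(2)[OF that] \<open>x \<in> U\<close> \<open>i < n\<close>])
          show "(\<lambda>s. f (y(j := s))) differentiable (at (y j))" if "j < m" "y \<in> V" for j y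
            using Suc.prems(1) that by simp
          show "continuous_map (subtopology (Euclidean_space m) V) euclideanreal (partial_deriv j f)"
            if "j < m" for j
            using Suc.prems(1) that by (intro C_k_imp_continuous_map[of m k]) simp
        qed
        then show ?thesis by simp
      qed
      show "C_k n k U (\<lambda>x. \<Sum>j<m. partial_deriv j f (g x) * partial_deriv i (\<lambda>x. g x j) x)"
        if "i < n" for i
      proof (intro C_k_sum[OF U] C_k_mult[OF U])
        fix j assume "j \<in> {..<m}"
        then have j: "j < m" by simp
        show "C_k n k U (\<lambda>x. partial_deriv j f (g x))"
        proof (rule Suc.IH)
          show "C_k m k V (partial_deriv j f)"
            using Suc.prems(1) j by simp
        qed (rule C_k_Suc_imp_C_k[OF Suc.prems(2)])
        show "C_k n k U (partial_deriv i (\<lambda>x. g x j))"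
          using Suc.prems(2)[OF j] that by simp
      qed
    qed
  qed
qed

lemma C_inf_subset: "C_inf n U m f \<Longrightarrow> V \<subseteq> U \<Longrightarrow> C_inf n V m f"
  unfolding C_inf_def using C_k_subset[of n _ U _ V] by blast

lemma C_inf_cong_imp:
  assumes "openin (Euclidean_space n) U" "C_inf n U m f" "\<And>x. x \<in> U \<Longrightarrow> f x = g x"
  shows "C_inf n U m g"
  unfolding C_inf_def
proof (intro conjI allI impI)
  show "g \<in> U \<rightarrow> euclid m"
    using assms(2,3) by (force simp: C_inf_def)
  show "C_k n k U (\<lambda>x. g x j)" if "j < m" for j k
  proof (rule C_k_cong_imp[OF assms(1)])
    show "C_k n k U (\<lambda>x. f x j)"
      using assms(2) that by (simp add: C_inf_def)
  qed (simp add: assms(3))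
qed

lemma C_inf_const: "c \<in> euclid m \<Longrightarrow> C_inf n U m (\<lambda>_. c)"
  unfolding C_inf_def by (simp add: C_k_const)

lemma C_inf_compose:
  assumes "openin (Euclidean_space n) U" "openin (Euclidean_space m) V"
    and "C_inf n U m g" "g \<in> U \<rightarrow> V" "C_inf m V p f"
  shows "C_inf n U p (\<lambda>x. f (g x))"
  unfolding C_inf_def
proof (intro conjI allI impI)
  show "(\<lambda>x. f (g x)) \<in> U \<rightarrow> euclid p"
    using assms(4,5) by (auto simp: C_inf_def)
  show "C_k n k U (\<lambda>x. f (g x) j)" if "j < p" for j k
  proof (rule C_k_compose[OF assms(1,2,4), where f = "\<lambda>y. f y j"])
    show "C_k n k U (\<lambda>x. g x i)" if "i < m" for i
      using assms(3) that by (simp add: C_inf_def)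
    show "C_k m k V (\<lambda>y. f y j)"
      using assms(5) that by (simp add: C_inf_def)
  qed
qed

lemma C_inf_imp_continuous_map:
  assumes "C_inf n U m f"
  shows "continuous_map (subtopology (Euclidean_space n) U) (Euclidean_space m) f"
proof (rule continuous_map_Euclidean_spaceI)
  show "f \<in> topspace (subtopology (Euclidean_space n) U) \<rightarrow> euclid m"
    using assms by (auto simp: C_inf_def)
  show "continuous_map (subtopology (Euclidean_space n) U) euclideanreal (\<lambda>x. f x j)" if "j < m" for j
    using assms that C_k_imp_continuous_map[of n 0 U "\<lambda>x. f x j"] unfolding C_inf_def by blast
qed


section \<open>Parametrizations with local lifts\<close>

text \<open>
  Sums of Euclidean spaces and their quotients are treated alike: in both cases the \<open>q i\<close> are the
  maps from the Euclidean spaces to the set in question.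
\<close>

definition locally_liftable :: "'t set \<Rightarrow> ('i \<Rightarrow> nat) \<Rightarrow> ('i \<Rightarrow> (nat \<Rightarrow> real) \<Rightarrow> 't) \<Rightarrow> 't plots"
  where "locally_liftable T k q = {(n, U, P) \<in> all_parametrizations T.
    \<forall>x\<in>U. \<exists>V i F. openin (Euclidean_space n) V \<and> x \<in> V \<and> V \<subseteq> U \<and>
      C_inf n V (k i) F \<and> (\<forall>y\<in>V. P y = q i (F y))}"

lemma locally_liftableI:
  assumes "openin (Euclidean_space n) U" "P \<in> U \<rightarrow>\<^sub>E T"
    and "\<And>x. x \<in> U \<Longrightarrow> \<exists>V i F. openin (Euclidean_space n) V \<and> x \<in> V \<and> V \<subseteq> U \<and>
      C_inf n V (k i) F \<and> (\<forall>y\<in>V. P y = q i (F y))"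
  shows "(n, U, P) \<in> locally_liftable T k q"
  using assms by (simp add: locally_liftable_def all_parametrizations_def)

lemma locally_liftableD:
  assumes "(n, U, P) \<in> locally_liftable T k q"
  shows "openin (Euclidean_space n) U" "P \<in> U \<rightarrow>\<^sub>E T"
    and "\<And>x. x \<in> U \<Longrightarrow> \<exists>V i F. openin (Euclidean_space n) V \<and> x \<in> V \<and> V \<subseteq> U \<and>
      C_inf n V (k i) F \<and> (\<forall>y\<in>V. P y = q i (F y))"
  using assms by (simp_all add: locally_liftable_def all_parametrizations_def)

text \<open>
  Constant maps lift because the images of the \<open>q i\<close> cover the set; the locality axiom holds because
  liftability is a local condition; and a lift \<open>F\<close> of a plot yields the lift \<open>F \<circ> G\<close> of its
  composition with a smooth map \<open>G\<close>, on the preimage under \<open>G\<close> of the domain of \<open>F\<close>.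
\<close>

lemma diffeology_locally_liftable:
  assumes "T \<noteq> {}" and cover: "\<And>s. s \<in> T \<Longrightarrow> \<exists>i. s \<in> q i ` euclid (k i)"
  shows "diffeology T (locally_liftable T k q)"
proof (rule diffeologyI[OF assms(1)])
  show "locally_liftable T k q \<subseteq> all_parametrizations T"
    unfolding locally_liftable_def by blast
  show "(n, euclid n, \<lambda>x\<in>euclid n. s) \<in> locally_liftable T k q" if s: "s \<in> T" for n s
  proof (rule locally_liftableI)
    obtain i c where "c \<in> euclid (k i)" "s = q i c"
      using cover[OF s] by blast
    then have "C_inf n (euclid n) (k i) (\<lambda>_. c)" "\<forall>y\<in>euclid n. (\<lambda>x\<in>euclid n. s) y = q i c"
      by (auto intro: C_inf_const)
    then show "\<exists>V i F. openin (Euclidean_space n) V \<and> x \<in> V \<and> V \<subseteq> euclid n \<and>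
        C_inf n V (k i) F \<and> (\<forall>y\<in>V. (\<lambda>x\<in>euclid n. s) y = q i (F y))" if "x \<in> euclid n" for x
      using that openin_topspace by blast
  qed (use s in auto)
  show "(n, U, P) \<in> locally_liftable T k q"
    if P: "(n, U, P) \<in> all_parametrizations T" and loc: "\<And>x. x \<in> U \<Longrightarrow>
      \<exists>V. openin (Euclidean_space n) V \<and> x \<in> V \<and> V \<subseteq> U \<and> (n, V, restrict P V) \<in> locally_liftable T k q"
    for n U P
  proof (rule locally_liftableI)
    show "openin (Euclidean_space n) U" "P \<in> U \<rightarrow>\<^sub>E T"
      using P by (simp_all add: all_parametrizations_def)
    fix x assume "x \<in> U"
    then obtain V where V: "x \<in> V" "V \<subseteq> U" "(n, V, restrict P V) \<in> locally_liftable T k q"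
      using loc by blast
    from locally_liftableD(3)[OF V(3,1)] obtain W i F where
      "openin (Euclidean_space n) W" "x \<in> W" "W \<subseteq> V" "C_inf n W (k i) F"
      "\<forall>y\<in>W. restrict P V y = q i (F y)"
      by blast
    moreover from this have "\<forall>y\<in>W. P y = q i (F y)"
      by (metis restrict_apply' subsetD)
    ultimately show "\<exists>V i F. openin (Euclidean_space n) V \<and> x \<in> V \<and> V \<subseteq> U \<and>
        C_inf n V (k i) F \<and> (\<forall>y\<in>V. P y = q i (F y))"
      using V(2) by (meson subset_trans)
  qed
  show "(l, W, compose W P G) \<in> locally_liftable T k q"
    if P: "(n, U, P) \<in> locally_liftable T k q" and W: "openin (Euclidean_space l) W"
      and G: "C_inf l W n G" "G ` W \<subseteq> U"
    for n U P l W G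
  proof (rule locally_liftableI[OF W])
    show "compose W P G \<in> W \<rightarrow>\<^sub>E T"
      using locally_liftableD(2)[OF P] G(2) by (auto simp: compose_def)
    fix x assume x: "x \<in> W"
    with G(2) have "G x \<in> U" by blast
    from locally_liftableD(3)[OF P this] obtain V i F where
      V: "openin (Euclidean_space n) V" "G x \<in> V" "C_inf n V (k i) F" "\<forall>y\<in>V. P y = q i (F y)"
      by blast
    define W' where "W' = {y \<in> W. G y \<in> V}"
    have "openin (subtopology (Euclidean_space l) W) W'"
      using openin_continuous_map_preimage[OF C_inf_imp_continuous_map[OF G(1)] V(1)]
        openin_Euclidean_space_subset[OF W] by (simp add: W'_def inf.absorb2)
    then have W': "openin (Euclidean_space l) W'"
      using W by (rule openin_trans_full)
    have "C_inf l W' (k i) (\<lambda>y. F (G y))"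
      using C_inf_subset[OF G(1), of W'] by (intro C_inf_compose[OF W' V(1) _ _ V(3)]) (auto simp: W'_def)
    moreover have "\<forall>y\<in>W'. compose W P G y = q i (F (G y))"
      using V(4) by (simp add: W'_def compose_def)
    ultimately show "\<exists>V i F. openin (Euclidean_space l) V \<and> x \<in> V \<and> V \<subseteq> W \<and>
        C_inf l V (k i) F \<and> (\<forall>y\<in>V. compose W P G y = q i (F y))"
      using W' x V(2) by (intro exI[of _ W'] exI[of _ i] exI[of _ "\<lambda>y. F (G y)"]) (auto simp: W'_def)
  qed
qed

text \<open>
  By the locality axiom, a diffeology contains every map that near each point coincides with one of
  its plots. This is the half of the universal property that makes the locally liftable maps the
  finest diffeology.
\<close>

lemma locally_liftable_subset_diffeology:
  assumes E: "diffeology T E"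
    and lifts: "\<And>n V i F. openin (Euclidean_space n) V \<Longrightarrow> C_inf n V (k i) F \<Longrightarrow>
      (n, V, \<lambda>y\<in>V. q i (F y)) \<in> E"
  shows "locally_liftable T k q \<subseteq> E"
proof clarify
  fix n U P assume P: "(n, U, P) \<in> locally_liftable T k q"
  show "(n, U, P) \<in> E"
  proof (rule diffeologyD(4)[OF E])
    show "(n, U, P) \<in> all_parametrizations T"
      using P by (simp add: locally_liftable_def)
    fix x assume "x \<in> U"
    from locally_liftableD(3)[OF P this] obtain V i F where
      V: "openin (Euclidean_space n) V" "x \<in> V" "V \<subseteq> U" "C_inf n V (k i) F" "\<forall>y\<in>V. P y = q i (F y)"
      by blast
    then have "restrict P V = (\<lambda>y\<in>V. q i (F y))"
      by (auto simp: restrict_def)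
    with lifts[OF V(1,4)] V(1-3)
    show "\<exists>V. openin (Euclidean_space n) V \<and> x \<in> V \<and> V \<subseteq> U \<and> (n, V, restrict P V) \<in> E"
      by (intro exI[of _ V]) simp
  qed
qed

lemma diffeology_locally_liftable_sum:
  "diffeology (SIGMA i:UNIV. euclid (k i)) (locally_liftable (SIGMA i:UNIV. euclid (k i)) k Pair)"
proof (rule diffeology_locally_liftable)
  have "(undefined, \<lambda>_. 0) \<in> (SIGMA i:UNIV. euclid (k i))"
    by (simp add: topspace_Euclidean_space)
  then show "(SIGMA i:UNIV. euclid (k i)) \<noteq> {}"
    by blast
qed auto

lemma locally_liftable_sumI:
  assumes "openin (Euclidean_space n) V" "C_inf n V (k i) F"
  shows "(n, V, \<lambda>y\<in>V. (i, F y)) \<in> locally_liftable (SIGMA i:UNIV. euclid (k i)) k Pair"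
proof (rule locally_liftableI[OF assms(1)])
  show "(\<lambda>y\<in>V. (i, F y)) \<in> V \<rightarrow>\<^sub>E (SIGMA i:UNIV. euclid (k i))"
    using assms(2) by (auto simp: C_inf_def)
  show "\<exists>W j G. openin (Euclidean_space n) W \<and> x \<in> W \<and> W \<subseteq> V \<and>
      C_inf n W (k j) G \<and> (\<forall>y\<in>W. (\<lambda>y\<in>V. (i, F y)) y = (j, G y))" if "x \<in> V" for x
    using assms that by (intro exI[of _ V] exI[of _ i] exI[of _ F]) simp
qed

text \<open>
  Each plot of the sum locally stays in one summand, since the maps with this property already form
  a diffeology containing the inclusions.
\<close>

lemma sum_euclid_diffeology_eq:
  fixes k :: "'i \<Rightarrow> nat"
  shows "sum_diffeology UNIV (\<lambda>i. euclid (k i)) (\<lambda>i. euclid_diffeology (k i)) =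
    locally_liftable (SIGMA i:UNIV. euclid (k i)) k Pair" (is "?D = ?L")
proof -
  let ?S = "SIGMA i:UNIV. euclid (k i)"
  have "euclid_diffeology l \<subseteq> all_parametrizations (euclid l)" for l
    unfolding euclid_diffeology_def all_parametrizations_def C_inf_def by (auto simp: PiE_def)
  note sum = sum_diffeology_finest[OF diffeologyD(1)[OF diffeology_locally_liftable_sum[of k]] this]
  show ?thesis
  proof
    have "restrict (Pair i) (euclid (k i)) \<in>
        diffeological_maps (euclid (k i)) (euclid_diffeology (k i)) ?S ?L" for i
      unfolding diffeological_maps_def
    proof clarify
      have "(n, U, compose U (restrict (Pair i) (euclid (k i))) P) \<in> ?L"
        if "(n, U, P) \<in> euclid_diffeology (k i)" for n U P
      proof -
        have P: "openin (Euclidean_space n) U" "C_inf n U (k i) P"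
          using that by (simp_all add: euclid_diffeology_def)
        then have "compose U (restrict (Pair i) (euclid (k i))) P = (\<lambda>y\<in>U. (i, P y))"
          by (auto simp: compose_def C_inf_def restrict_def fun_eq_iff)
        then show ?thesis
          using locally_liftable_sumI[where k = k, OF P] by simp
      qed
      then show "restrict (Pair i) (euclid (k i)) \<in> euclid (k i) \<rightarrow>\<^sub>E ?S \<and>
          (\<forall>(n, U, P)\<in>euclid_diffeology (k i).
             (n, U, compose U (restrict (Pair i) (euclid (k i))) P) \<in> ?L)"
        by auto
    qed
    then show "?D \<subseteq> ?L"
      using sum diffeology_locally_liftable_sum[of k] by blast
    show "?L \<subseteq> ?D"
    proof (rule locally_liftable_subset_diffeology)
      show "diffeology ?S ?D"
        using sum by blast
      fix n V i F assume V: "openin (Euclidean_space n) V" and F: "C_inf n V (k i) F"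
      have "(n, V, restrict F V) \<in> euclid_diffeology (k i)"
        using V C_inf_cong_imp[OF V F, of "restrict F V"] by (simp add: euclid_diffeology_def)
      moreover have "restrict (Pair i) (euclid (k i)) \<in>
          diffeological_maps (euclid (k i)) (euclid_diffeology (k i)) ?S ?D"
        using sum by blast
      ultimately have "(n, V, compose V (restrict (Pair i) (euclid (k i))) (restrict F V)) \<in> ?D"
        unfolding diffeological_maps_def by blast
      moreover have "compose V (restrict (Pair i) (euclid (k i))) (restrict F V) = (\<lambda>y\<in>V. (i, F y))"
        using F by (auto simp: compose_def C_inf_def restrict_def fun_eq_iff)
      ultimately show "(n, V, \<lambda>y\<in>V. (i, F y)) \<in> ?D"
        by simp
    qed
  qed
qed

text \<open>
  A local lift of a plot of the sum to a summand \<open>i\<close> is a local lift of its image in the quotient along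
  \<open>q \<circ> Pair i\<close>, so \<open>q\<close> is smooth for the liftable maps; surjectivity of \<open>q\<close> makes constant maps
  liftable.
\<close>

lemma quotient_of_sum_diffeology_eq:
  fixes k :: "'i \<Rightarrow> nat"
  defines "S \<equiv> (SIGMA i:UNIV. euclid (k i))"
  assumes q: "q ` S = T"
  shows "quotient_diffeology S (locally_liftable S k Pair) T q =
    locally_liftable T k (\<lambda>i x. q (i, x))" (is "?D = ?L")
proof -
  have S: "diffeology S (locally_liftable S k Pair)"
    unfolding S_def by (rule diffeology_locally_liftable_sum)
  then have "T \<noteq> {}"
    using diffeologyD(1) q by blast
  have qST: "q \<in> S \<rightarrow> T"
    using q by blast
  note quot = quotient_diffeology_finest[OF \<open>T \<noteq> {}\<close> diffeologyD(2)[OF S] qST]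
  have L: "diffeology T ?L"
    using q by (intro diffeology_locally_liftable[OF \<open>T \<noteq> {}\<close>]) (force simp: S_def)
  show ?thesis
  proof
    have "(n, U, compose U (restrict q S) P) \<in> ?L" if P: "(n, U, P) \<in> locally_liftable S k Pair" for n U P
    proof (rule locally_liftableI)
      note P = locally_liftableD[OF P]
      show "openin (Euclidean_space n) U"
        by (fact P(1))
      show "compose U (restrict q S) P \<in> U \<rightarrow>\<^sub>E T"
        using P(2) qST by (auto simp: compose_def)
      fix x assume "x \<in> U"
      from P(3)[OF this] obtain V i F where V: "openin (Euclidean_space n) V" "x \<in> V" "V \<subseteq> U"
        "C_inf n V (k i) F" "\<forall>y\<in>V. P y = (i, F y)"
        by blast
      have "compose U (restrict q S) P y = q (i, F y)" if "y \<in> V" for y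
      proof -
        have "y \<in> U" "P y = (i, F y)"
          using that V(3,5) by blast+
        moreover from this P(2) have "(i, F y) \<in> S"
          by (metis PiE_mem)
        ultimately show ?thesis
          by (simp add: compose_def)
      qed
      then show "\<exists>V i F. openin (Euclidean_space n) V \<and> x \<in> V \<and> V \<subseteq> U \<and>
          C_inf n V (k i) F \<and> (\<forall>y\<in>V. compose U (restrict q S) P y = q (i, F y))"
        using V(1-4) by blast
    qed
    then have "restrict q S \<in> diffeological_maps S (locally_liftable S k Pair) T ?L"
      using qST unfolding diffeological_maps_def by auto
    then show "?D \<subseteq> ?L"
      using quot L by blast
    show "?L \<subseteq> ?D"
    proof (rule locally_liftable_subset_diffeology)
      show "diffeology T ?D"
        using quot by blast
      fix n V i F assume V: "openin (Euclidean_space n) V" and F: "C_inf n V (k i) F"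
      have "(n, V, \<lambda>y\<in>V. (i, F y)) \<in> locally_liftable S k Pair"
        unfolding S_def by (rule locally_liftable_sumI[where k = k, OF V F])
      moreover have "restrict q S \<in> diffeological_maps S (locally_liftable S k Pair) T ?D"
        using quot by blast
      ultimately have "(n, V, compose V (restrict q S) (\<lambda>y\<in>V. (i, F y))) \<in> ?D"
        unfolding diffeological_maps_def by blast
      moreover have "compose V (restrict q S) (\<lambda>y\<in>V. (i, F y)) = (\<lambda>y\<in>V. q (i, F y))"
        using F by (auto simp: compose_def C_inf_def restrict_def fun_eq_iff S_def)
      ultimately show "(n, V, \<lambda>y\<in>V. q (i, F y)) \<in> ?D"
        by simp
    qed
  qed
qed

lemma canonical_diffeology_eq:
  "canonical_diffeology = locally_liftable Bar (\<lambda>(m, n). 2 * m + n) (\<lambda>(m, n). Q m n)"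
proof -
  define k :: "nat \<times> nat \<Rightarrow> nat" where "k = (\<lambda>(m, n). 2 * m + n)"
  define q :: "(nat \<times> nat) \<times> (nat \<Rightarrow> real) \<Rightarrow> barcode" where "q = (\<lambda>((m, n), x). Q m n x)"
  have euclid: "(\<lambda>(m, n). euclid (2 * m + n)) = (\<lambda>i. euclid (k i))"
    and diffeology: "(\<lambda>(m, n). euclid_diffeology (2 * m + n)) = (\<lambda>i. euclid_diffeology (k i))"
    and q: "(\<lambda>i x. q (i, x)) = (\<lambda>(m, n). Q m n)"
    by (auto simp: k_def q_def fun_eq_iff)
  have ob: "ordered_barcodes = (SIGMA i:UNIV. euclid (k i))"
    by (simp only: ordered_barcodes_def euclid)
  have "ordered_barcode_diffeology = locally_liftable ordered_barcodes k Pair"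
    by (simp only: ordered_barcode_diffeology_def euclid diffeology sum_euclid_diffeology_eq ob)
  then have "canonical_diffeology =
      quotient_diffeology ordered_barcodes (locally_liftable ordered_barcodes k Pair) Bar q"
    by (simp only: canonical_diffeology_def q_def)
  also have "\<dots> = locally_liftable Bar k (\<lambda>i x. q (i, x))"
    unfolding ob by (rule quotient_of_sum_diffeology_eq) (use Q_image in \<open>simp only: ob q_def\<close>)
  finally show ?thesis
    by (simp only: q k_def)
qed


section \<open>Smooth maps from Euclidean domains to a manifold and from a manifold to Euclidean space\<close>

lemma smooth_manifoldD:
  assumes "smooth_manifold M" "(U, \<phi>) \<in> matlas M"
  shows "openin (mtop M) U" "openin (Euclidean_space (mdim M)) (\<phi> ` U)"
    and "homeomorphic_map (subtopology (mtop M) U) (subtopology (Euclidean_space (mdim M)) (\<phi> ` U)) \<phi>"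
    and "inj_on \<phi> U"
    and "(V, \<psi>) \<in> matlas M \<Longrightarrow> C_inf (mdim M) (\<phi> ` (U \<inter> V)) (mdim M) (\<lambda>x. \<psi> (inv_into U \<phi> x))"
proof -
  note * = assms(1)[unfolded smooth_manifold_def]
  note ** = *[THEN conjunct2, THEN conjunct2, THEN conjunct2, THEN conjunct1, THEN bspec, OF assms(2), unfolded split]
  show U: "openin (mtop M) U" "openin (Euclidean_space (mdim M)) (\<phi> ` U)"
    and hom: "homeomorphic_map (subtopology (mtop M) U) (subtopology (Euclidean_space (mdim M)) (\<phi> ` U)) \<phi>"
    using ** by blast+
  show "inj_on \<phi> U"
    using homeomorphic_imp_injective_map[OF hom] openin_subset[OF U(1)] by (simp add: inf.absorb2)
  show "C_inf (mdim M) (\<phi> ` (U \<inter> V)) (mdim M) (\<lambda>x. \<psi> (inv_into U \<phi> x))" if "(V, \<psi>) \<in> matlas M"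
    using *[THEN conjunct2, THEN conjunct2, THEN conjunct2, THEN conjunct2, THEN bspec, OF assms(2), unfolded split,
        THEN bspec, OF that, unfolded split] by (simp add: o_def)
qed

lemma chart_at:
  assumes "smooth_manifold M" "x \<in> topspace (mtop M)"
  obtains U \<phi> where "(U, \<phi>) \<in> matlas M" "x \<in> U"
proof -
  have "(\<Union>(U, \<phi>)\<in>matlas M. U) = topspace (mtop M)"
    using assms(1) by (simp add: smooth_manifold_def)
  then show thesis
    using assms(2) that by blast
qed

lemma openin_chart_image:
  assumes M: "smooth_manifold M" "(U, \<phi>) \<in> matlas M" and W: "openin (mtop M) W" "W \<subseteq> U"
  shows "openin (Euclidean_space (mdim M)) (\<phi> ` W)"
proof -
  have "openin (subtopology (mtop M) U) W"
    using W by (simp add: openin_subset_topspace_eq openin_open_subtopology[OF smooth_manifoldD(1)[OF M]])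
  then have "openin (subtopology (Euclidean_space (mdim M)) (\<phi> ` U)) (\<phi> ` W)"
    using homeomorphic_map_openness_eq[OF smooth_manifoldD(3)[OF M]] by blast
  then show ?thesis
    using smooth_manifoldD(2)[OF M] by (rule openin_trans_full)
qed

lemma continuous_map_inv_chart:
  assumes M: "smooth_manifold M" "(U, \<phi>) \<in> matlas M"
  shows "continuous_map (subtopology (Euclidean_space (mdim M)) (\<phi> ` U)) (mtop M) (inv_into U \<phi>)"
proof -
  obtain g where g: "homeomorphic_maps (subtopology (mtop M) U)
      (subtopology (Euclidean_space (mdim M)) (\<phi> ` U)) \<phi> g"
    using smooth_manifoldD(3)[OF M] homeomorphic_map_maps by blast
  have U: "U \<subseteq> topspace (mtop M)"
    using openin_subset[OF smooth_manifoldD(1)[OF M]] .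
  have "continuous_map (subtopology (Euclidean_space (mdim M)) (\<phi> ` U)) (mtop M) g"
    using g by (auto simp: homeomorphic_maps_def continuous_map_in_subtopology)
  moreover have "g x = inv_into U \<phi> x" if "x \<in> \<phi> ` U" for x
    using that g U inv_into_f_f[OF smooth_manifoldD(4)[OF M]] by (auto simp: homeomorphic_maps_def)
  ultimately show ?thesis
    by (auto intro: continuous_map_eq)
qed

text \<open>
  The open set \<open>W\<close> on which the composition of a plot with a chart is considered may be smaller than
  the preimage of the chart domain, since the lifts of barcode-valued maps exist only locally.
\<close>

lemma manifold_plotD:
  assumes P: "(n, U, P) \<in> manifold_diffeology M"
  shows "openin (Euclidean_space n) U"
    and "continuous_map (subtopology (Euclidean_space n) U) (mtop M) P"
    and "\<And>V \<psi> W. (V, \<psi>) \<in> matlas M \<Longrightarrow> openin (Euclidean_space n) W \<Longrightarrow> W \<subseteq> U \<inter> P -` V \<Longrightarrow>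
      C_inf n W (mdim M) (\<lambda>x. \<psi> (P x))"
proof -
  have smooth: "smooth_map (open_submanifold (euclid_manifold n) U) M P"
    using P by (simp add: manifold_diffeology_def)
  show U: "openin (Euclidean_space n) U"
    using P by (simp add: manifold_diffeology_def)
  show "continuous_map (subtopology (Euclidean_space n) U) (mtop M) P"
    using smooth by (simp add: smooth_map_def open_submanifold_def euclid_manifold_def)
  fix V \<psi> W assume V: "(V, \<psi>) \<in> matlas M" and W: "openin (Euclidean_space n) W" "W \<subseteq> U \<inter> P -` V"
  have id: "inv_into U (\<lambda>x. x) x = x" if "x \<in> U" for x
    using inv_into_f_f[of "\<lambda>x. x" U x] that by (simp add: inj_on_def)
  have "C_inf n (U \<inter> P -` V) (mdim M) (\<psi> \<circ> P \<circ> inv_into U (\<lambda>x. x))"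
    using smooth V openin_Euclidean_space_subset[OF U]
    by (auto simp: smooth_map_def open_submanifold_def euclid_manifold_def inf.absorb2)
  from C_inf_subset[OF this W(2)]
  show "C_inf n W (mdim M) (\<lambda>x. \<psi> (P x))"
    by (rule C_inf_cong_imp[OF W(1)]) (use W(2) id in auto)
qed

text \<open>
  In the charts of the manifold, the inverse of a chart is a transition map. It is the plot on which
  smoothness of maps out of the manifold is tested.
\<close>

lemma inv_chart_plot:
  assumes M: "smooth_manifold M" "(U, \<phi>) \<in> matlas M"
  shows "(mdim M, \<phi> ` U, restrict (inv_into U \<phi>) (\<phi> ` U)) \<in> manifold_diffeology M"
proof -
  let ?O = "\<phi> ` U" and ?P = "restrict (inv_into U \<phi>) (\<phi> ` U)"
  note U = smooth_manifoldD[OF M]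
  have "continuous_map (subtopology (Euclidean_space (mdim M)) ?O) (mtop M) ?P"
    by (rule continuous_map_eq[OF continuous_map_inv_chart[OF M]]) simp
  moreover have "C_inf (mdim M) (?O \<inter> ?P -` V) (mdim M) (\<psi> \<circ> ?P \<circ> inv_into ?O (\<lambda>x. x))"
    if V: "(V, \<psi>) \<in> matlas M" for V \<psi>
  proof -
    have eq: "?O \<inter> ?P -` V = \<phi> ` (U \<inter> V)"
      using inv_into_f_f[OF U(4)] by force
    have "openin (Euclidean_space (mdim M)) (\<phi> ` (U \<inter> V))"
      using openin_chart_image[OF M] U(1) smooth_manifoldD(1)[OF M(1) V] by blast
    moreover have "inv_into ?O (\<lambda>x. x) x = x" if "x \<in> ?O" for x
      using inv_into_f_f[of "\<lambda>x. x" ?O x] that by (simp add: inj_on_def)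
    ultimately show ?thesis
      unfolding eq by (intro C_inf_cong_imp[OF _ U(5)[OF V]]) auto
  qed
  ultimately show ?thesis
    using U(2) openin_Euclidean_space_subset[OF U(2)]
    by (auto simp: manifold_diffeology_def smooth_map_def open_submanifold_def euclid_manifold_def inf.absorb2)
qed

text \<open>
  The charts of an open submanifold are restrictions of charts \<open>\<psi>\<close> on \<open>V\<close>, and on the image of the
  smaller domain the two choices of inverse agree; this removes the dependence of
  \<^const>\<open>inv_into\<close> on the submanifold.
\<close>

lemma smooth_map_to_euclid_iff:
  assumes M: "smooth_manifold M" and W: "openin (mtop M) W"
  shows "smooth_map (open_submanifold M W) (euclid_manifold l) F \<longleftrightarrow>
    continuous_map (subtopology (mtop M) W) (Euclidean_space l) F \<and>
    (\<forall>(V, \<psi>)\<in>matlas M. C_inf (mdim M) (\<psi> ` (V \<inter> W)) l (\<lambda>x. F (inv_into V \<psi> x)))"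
proof -
  have "C_inf (mdim M) (\<psi> ` (V \<inter> W \<inter> F -` euclid l)) l ((\<lambda>x. x) \<circ> F \<circ> inv_into (V \<inter> W) \<psi>) \<longleftrightarrow>
      C_inf (mdim M) (\<psi> ` (V \<inter> W)) l (\<lambda>x. F (inv_into V \<psi> x))"
    if cont: "continuous_map (subtopology (mtop M) W) (Euclidean_space l) F" and V: "(V, \<psi>) \<in> matlas M"
    for V \<psi>
  proof -
    have "F \<in> W \<rightarrow> euclid l"
      using continuous_map_funspace[OF cont] openin_subset[OF W] by (simp add: inf.absorb2)
    then have eq: "V \<inter> W \<inter> F -` euclid l = V \<inter> W"
      by auto
    have "inj_on \<psi> (V \<inter> W)"
      using smooth_manifoldD(4)[OF M V] inj_on_subset by blast
    then have inv: "inv_into (V \<inter> W) \<psi> x = inv_into V \<psi> x" if "x \<in> \<psi> ` (V \<inter> W)" for x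
      using that smooth_manifoldD(4)[OF M V] by (auto simp: inv_into_f_f)
    have "openin (Euclidean_space (mdim M)) (\<psi> ` (V \<inter> W))"
      using openin_chart_image[OF M V] smooth_manifoldD(1)[OF M V] W by blast
    then show ?thesis
      unfolding eq using inv by (auto intro: C_inf_cong_imp)
  qed
  then show ?thesis
    by (fastforce simp: smooth_map_def open_submanifold_def euclid_manifold_def)
qed


section \<open>Smooth maps to the space of barcodes\<close>

text \<open>
  If \<open>F\<close> lifts \<open>B\<close> composed with the inverse of the chart \<open>\<phi>\<close> near \<open>\<phi> x\<close>, then \<open>F \<circ> \<phi>\<close> lifts \<open>B\<close> near
  \<open>x\<close>; read in any other chart, it is the composition of a transition map with \<open>F\<close>.
\<close>

lemma chart_plot_imp_inf_differentiable_at: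
  assumes M: "smooth_manifold M" "(U, \<phi>) \<in> matlas M" "x \<in> U"
    and lift: "(mdim M, \<phi> ` U, compose (\<phi> ` U) B (restrict (inv_into U \<phi>) (\<phi> ` U))) \<in> canonical_diffeology"
  shows "inf_differentiable_at M B x"
proof -
  note U = smooth_manifoldD[OF M(1,2)]
  from M(3) have "\<phi> x \<in> \<phi> ` U" by blast
  from locally_liftableD(3)[OF lift[unfolded canonical_diffeology_eq] this]
  obtain O' m n F where O': "openin (Euclidean_space (mdim M)) O'" "\<phi> x \<in> O'" "O' \<subseteq> \<phi> ` U"
    and F: "C_inf (mdim M) O' (2 * m + n) F"
    and BF: "\<forall>y\<in>O'. compose (\<phi> ` U) B (restrict (inv_into U \<phi>) (\<phi> ` U)) y = Q m n (F y)"
    by auto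
  define W where "W = {y \<in> U. \<phi> y \<in> O'}"
  have \<phi>_cont: "continuous_map (subtopology (mtop M) U) (Euclidean_space (mdim M)) \<phi>"
    using homeomorphic_imp_continuous_map[OF U(3)] by (simp add: continuous_map_in_subtopology)
  have W: "openin (mtop M) W"
    using openin_trans_full[OF openin_continuous_map_preimage[OF \<phi>_cont O'(1)] U(1)]
      openin_subset[OF U(1)] by (simp add: W_def inf.absorb2)
  have "smooth_map (open_submanifold M W) (euclid_manifold (2 * m + n)) (\<lambda>y. F (\<phi> y))"
    unfolding smooth_map_to_euclid_iff[OF M(1) W]
  proof (intro conjI ballI; clarify?)
    have "continuous_map (subtopology (mtop M) W) (Euclidean_space (mdim M)) \<phi>"
      using \<phi>_cont by (rule continuous_map_from_subtopology_mono) (auto simp: W_def)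
    then have "continuous_map (subtopology (mtop M) W) (subtopology (Euclidean_space (mdim M)) O') \<phi>"
      by (auto simp: continuous_map_in_subtopology W_def)
    from continuous_map_compose[OF this C_inf_imp_continuous_map[OF F]]
    show "continuous_map (subtopology (mtop M) W) (Euclidean_space (2 * m + n)) (\<lambda>y. F (\<phi> y))"
      by (simp add: o_def)
    fix V \<psi> assume V: "(V, \<psi>) \<in> matlas M"
    show "C_inf (mdim M) (\<psi> ` (V \<inter> W)) (2 * m + n) (\<lambda>y. F (\<phi> (inv_into V \<psi> y)))"
    proof (rule C_inf_compose[OF _ O'(1) _ _ F])
      show "C_inf (mdim M) (\<psi> ` (V \<inter> W)) (mdim M) (\<lambda>y. \<phi> (inv_into V \<psi> y))"
        using smooth_manifoldD(5)[OF M(1) V M(2)] by (rule C_inf_subset) (auto simp: W_def)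
      show "openin (Euclidean_space (mdim M)) (\<psi> ` (V \<inter> W))"
        using openin_chart_image[OF M(1) V] smooth_manifoldD(1)[OF M(1) V] W by blast
      show "(\<lambda>y. \<phi> (inv_into V \<psi> y)) \<in> \<psi> ` (V \<inter> W) \<rightarrow> O'"
        using smooth_manifoldD(4)[OF M(1) V] by (auto simp: W_def inv_into_f_f)
    qed
  qed
  moreover have "B y = Q m n (F (\<phi> y))" if "y \<in> W" for y
    using that BF inv_into_f_f[OF U(4)] by (auto simp: W_def compose_def)
  moreover have "x \<in> W"
    using M(3) O'(2) by (simp add: W_def)
  ultimately show ?thesis
    using W unfolding inf_differentiable_at_def by blast
qed

text \<open>
  A lift \<open>F\<close> of \<open>B\<close> near \<open>P x\<close> gives the lift \<open>F \<circ> P\<close> of \<open>B \<circ> P\<close> near \<open>x\<close>. It is smooth because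
  with a chart \<open>\<psi>\<close> at \<open>P x\<close> it factors through the smooth maps \<open>\<psi> \<circ> P\<close> and \<open>F \<circ> \<psi>\<^sup>-\<^sup>1\<close>.
\<close>

lemma inf_differentiable_imp_plot:
  assumes M: "smooth_manifold M" and B: "B \<in> topspace (mtop M) \<rightarrow>\<^sub>E Bar"
    and diff: "\<And>x. x \<in> topspace (mtop M) \<Longrightarrow> inf_differentiable_at M B x"
    and plot: "(n, U, P) \<in> manifold_diffeology M"
  shows "(n, U, compose U B P) \<in> canonical_diffeology"
  unfolding canonical_diffeology_eq
proof (rule locally_liftableI)
  note P = manifold_plotD[OF plot]
  have top: "topspace (subtopology (Euclidean_space n) U) = U"
    using openin_Euclidean_space_subset[OF P(1)] by auto
  have PU: "P \<in> U \<rightarrow> topspace (mtop M)"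
    using continuous_map_funspace[OF P(2)] unfolding top .
  show "openin (Euclidean_space n) U"
    by (fact P(1))
  show "compose U B P \<in> U \<rightarrow>\<^sub>E Bar"
    using B PU by (auto simp: compose_def)
  fix x assume x: "x \<in> U"
  with PU have Px: "P x \<in> topspace (mtop M)" by blast
  from diff[OF this] obtain W m l F where W: "openin (mtop M) W" "P x \<in> W"
    and F: "smooth_map (open_submanifold M W) (euclid_manifold (2 * m + l)) F"
    and BF: "\<forall>y\<in>W. B y = Q m l (F y)"
    unfolding inf_differentiable_at_def by blast
  obtain V \<psi> where V: "(V, \<psi>) \<in> matlas M" "P x \<in> V"
    using chart_at[OF M Px] .
  note V' = smooth_manifoldD[OF M V(1)]
  define N where "N = {y \<in> U. P y \<in> V \<inter> W}"
  have "openin (subtopology (Euclidean_space n) U) N"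
    using openin_continuous_map_preimage[OF P(2) openin_Int[OF V'(1) W(1)]]
    unfolding top N_def .
  then have N: "openin (Euclidean_space n) N"
    using P(1) by (rule openin_trans_full)
  have "C_inf n N (2 * m + l) (\<lambda>y. F (inv_into V \<psi> (\<psi> (P y))))"
  proof (rule C_inf_compose[OF N, where g = "\<lambda>y. \<psi> (P y)" and f = "\<lambda>z. F (inv_into V \<psi> z)"])
    show "openin (Euclidean_space (mdim M)) (\<psi> ` (V \<inter> W))"
      using openin_chart_image[OF M V(1)] V'(1) W(1) by blast
    show "C_inf n N (mdim M) (\<lambda>y. \<psi> (P y))"
      by (rule P(3)[OF V(1) N]) (auto simp: N_def)
    show "C_inf (mdim M) (\<psi> ` (V \<inter> W)) (2 * m + l) (\<lambda>z. F (inv_into V \<psi> z))"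
      using bspec[OF conjunct2[OF F[unfolded smooth_map_to_euclid_iff[OF M W(1)]]] V(1)] by simp
    show "(\<lambda>y. \<psi> (P y)) \<in> N \<rightarrow> \<psi> ` (V \<inter> W)"
      by (auto simp: N_def)
  qed
  moreover have "compose U B P y = Q m l (F (inv_into V \<psi> (\<psi> (P y))))" if "y \<in> N" for y
    using that BF inv_into_f_f[OF V'(4)] by (simp add: N_def compose_def)
  moreover have "x \<in> N" "N \<subseteq> U"
    using x V(2) W(2) by (auto simp: N_def)
  ultimately show "\<exists>V i F. openin (Euclidean_space n) V \<and> x \<in> V \<and> V \<subseteq> U \<and>
      C_inf n V ((\<lambda>(m, n). 2 * m + n) i) F \<and> (\<forall>y\<in>V. compose U B P y = (\<lambda>(m, n). Q m n) i (F y))"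
    using N by (intro exI[of _ N] exI[of _ "(m, l)"] exI[of _ "\<lambda>y. F (inv_into V \<psi> (\<psi> (P y)))"]) simp
qed

theorem corollary3p20:
  fixes M :: "'a manifold"
  assumes "smooth_manifold M"
  shows "diffeological_maps (topspace (mtop M)) (manifold_diffeology M) Bar canonical_diffeology =
    {B \<in> topspace (mtop M) \<rightarrow>\<^sub>E Bar. \<forall>x\<in>topspace (mtop M). inf_differentiable_at M B x}"
proof (intro subset_antisym subsetI)
  fix B assume B: "B \<in> diffeological_maps (topspace (mtop M)) (manifold_diffeology M) Bar canonical_diffeology"
  have "inf_differentiable_at M B x" if x: "x \<in> topspace (mtop M)" for x
  proof -
    obtain U \<phi> where U: "(U, \<phi>) \<in> matlas M" "x \<in> U"
      using chart_at[OF assms x] .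
    then show ?thesis
      using B inv_chart_plot[OF assms U(1)]
      by (intro chart_plot_imp_inf_differentiable_at[OF assms U])
        (auto simp: diffeological_maps_def)
  qed
  with B show "B \<in> {B \<in> topspace (mtop M) \<rightarrow>\<^sub>E Bar. \<forall>x\<in>topspace (mtop M). inf_differentiable_at M B x}"
    by (simp add: diffeological_maps_def)
next
  fix B assume "B \<in> {B \<in> topspace (mtop M) \<rightarrow>\<^sub>E Bar. \<forall>x\<in>topspace (mtop M). inf_differentiable_at M B x}"
  then show "B \<in> diffeological_maps (topspace (mtop M)) (manifold_diffeology M) Bar canonical_diffeology"
    using inf_differentiable_imp_plot[OF assms] by (auto simp: diffeological_maps_def)
qed

end
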